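(* There exists a Latin square $L$ of dimension $m=2^n$ such that the randomized communication complexity of $f_L$ is $\Omega(n)$; that is, there is an absolute constant $c>0$ such that for all sufficiently large $n$ there is a Latin square $L$ of dimension $2^n$ with $R(f_L)\ge cn$.
   Context: A Latin square of dimension $m$ is a matrix $L\in[m]^{m\times m}$ every row and every column of which is a permutation of $[m]$. For such $L$, identify $[m]$ with $\{0,1\}^n$ and define the $3$-argument function $f_L:[m]\times[m]\times[m]\to\{0,1\}$ by $f_L(x,y,z)=1$ iff $L[x,y]\neq z$. In the $3$-party "number in hand" model, player $i$ holds the $i$-th argument and the players communicate over a broadcast channel; $R(f)$ is the worst-case number of bits communicated by the best randomized protocol that outputs $f(x,y,z)$ correctly with probability at least $2/3$ on every input $(x,y,z)$. *)

theory Defs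
  imports "HOL-Probability.Probability_Mass_Function"
begin

definition latin_square :: "nat \<Rightarrow> (nat \<Rightarrow> nat \<Rightarrow> nat) \<Rightarrow> bool" where
  "latin_square m L \<longleftrightarrow>
     (\<forall>x\<in>{1..m}. bij_betw (\<lambda>y. L x y) {1..m} {1..m}) \<and>
     (\<forall>y\<in>{1..m}. bij_betw (\<lambda>x. L x y) {1..m} {1..m})"

definition latin_fun :: "(nat \<Rightarrow> nat \<Rightarrow> nat) \<Rightarrow> nat \<Rightarrow> nat \<Rightarrow> nat \<Rightarrow> bool" where
  "latin_fun L x y z \<longleftrightarrow> L x y \<noteq> z"

datatype player = Player1 | Player2 | Player3

text \<open>
  Deterministic broadcast protocols for three players are binary trees. At a node \<open>Speak i b P Q\<close>,
  player \<open>i\<close> broadcasts the bit \<open>b w\<close>, where \<open>w\<close> is the input held by that player, and the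
  protocol continues with \<open>P\<close> if the bit is 1 and with \<open>Q\<close> if it is 0. The dependence of the bit
  on the preceding transcript is encoded in the position of the node. The output is a function of
  the transcript.
\<close>

datatype 'a protocol =
    Output bool
  | Speak player "'a \<Rightarrow> bool" "'a protocol" "'a protocol"

fun held_input :: "player \<Rightarrow> 'a \<Rightarrow> 'a \<Rightarrow> 'a \<Rightarrow> 'a" where
  "held_input Player1 x y z = x"
| "held_input Player2 x y z = y"
| "held_input Player3 x y z = z"

fun protocol_output :: "'a protocol \<Rightarrow> 'a \<Rightarrow> 'a \<Rightarrow> 'a \<Rightarrow> bool" where
  "protocol_output (Output v) x y z = v"
| "protocol_output (Speak i b P Q) x y z =
     (if b (held_input i x y z) then protocol_output P x y z else protocol_output Q x y z)"

fun bits_sent :: "'a protocol \<Rightarrow> 'a \<Rightarrow> 'a \<Rightarrow> 'a \<Rightarrow> nat" where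
  "bits_sent (Output v) x y z = 0"
| "bits_sent (Speak i b P Q) x y z =
     Suc (if b (held_input i x y z) then bits_sent P x y z else bits_sent Q x y z)"

text \<open>
  A randomized protocol is a probability distribution on deterministic protocols. This is the
  public-coin model; private coins are the special case in which disjoint parts of the shared
  random string are used by the individual players. Discrete distributions suffice: on a finite
  input set there are only finitely many deterministic protocols of a given cost, up to their
  behaviour on that set.
\<close>

definition cost_at_most :: "'a set \<Rightarrow> 'a protocol pmf \<Rightarrow> nat \<Rightarrow> bool" where
  "cost_at_most A D k \<longleftrightarrow>
     (\<forall>P\<in>set_pmf D. \<forall>x\<in>A. \<forall>y\<in>A. \<forall>z\<in>A. bits_sent P x y z \<le> k)"

definition computes :: "'a set \<Rightarrow> 'a protocol pmf \<Rightarrow> ('a \<Rightarrow> 'a \<Rightarrow> 'a \<Rightarrow> bool) \<Rightarrow> bool" where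
  "computes A D f \<longleftrightarrow>
     (\<forall>x\<in>A. \<forall>y\<in>A. \<forall>z\<in>A.
        measure_pmf.prob D {P. protocol_output P x y z = f x y z} \<ge> 2 / 3)"

definition rand_comm :: "'a set \<Rightarrow> ('a \<Rightarrow> 'a \<Rightarrow> 'a \<Rightarrow> bool) \<Rightarrow> nat" where
  "rand_comm A f = Inf {k. \<exists>D. cost_at_most A D k \<and> computes A D f}"

text \<open>
  On a finite input set every function has a randomized protocol, so the infimum above is a minimum.
\<close>

lemma ex_protocol_announce:
  assumes "finite A"
  shows "\<exists>P. \<forall>x y z. held_input i x y z \<in> A \<longrightarrow>
           protocol_output P x y z = protocol_output (Q (held_input i x y z)) x y z"
  using assms
proof (induction A rule: finite_induct)
  case empty
  then show ?case by simp
next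
  case (insert a A)
  then obtain P where P: "\<forall>x y z. held_input i x y z \<in> A \<longrightarrow>
      protocol_output P x y z = protocol_output (Q (held_input i x y z)) x y z"
    by blast
  show ?case
    by (rule exI[of _ "Speak i (\<lambda>w. w = a) (Q a) P"]) (use P in auto)
qed

lemma ex_det_protocol:
  assumes "finite A"
  shows "\<exists>P. \<forall>x\<in>A. \<forall>y\<in>A. \<forall>z\<in>A. protocol_output P x y z = f x y z"
proof -
  have "\<exists>P. \<forall>x' y' z. z \<in> A \<longrightarrow> protocol_output P x' y' z = f x y z" for x y
    using ex_protocol_announce[OF assms, of Player3 "\<lambda>z. Output (f x y z)"] by simp
  then obtain P3 where P3: "\<And>x y x' y' z. z \<in> A \<Longrightarrow> protocol_output (P3 x y) x' y' z = f x y z"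
    by metis
  have "\<exists>P. \<forall>x' y z. y \<in> A \<longrightarrow> protocol_output P x' y z = protocol_output (P3 x y) x' y z" for x
    using ex_protocol_announce[OF assms, of Player2 "P3 x"] by simp
  then obtain P2 where P2: "\<And>x x' y z. y \<in> A \<Longrightarrow>
      protocol_output (P2 x) x' y z = protocol_output (P3 x y) x' y z"
    by metis
  obtain P1 where "\<forall>x y z. x \<in> A \<longrightarrow> protocol_output P1 x y z = protocol_output (P2 x) x y z"
    using ex_protocol_announce[OF assms, of Player1 P2] by auto
  then show ?thesis
    using P2 P3 by (intro exI[of _ P1]) simp
qed

lemma bits_sent_le_size: "bits_sent P x y z \<le> size P"
  by (induction P) auto

lemma rand_comm_attained:
  assumes "finite A"
  shows "\<exists>D. cost_at_most A D (rand_comm A f) \<and> computes A D f"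
proof -
  obtain P where P: "\<forall>x\<in>A. \<forall>y\<in>A. \<forall>z\<in>A. protocol_output P x y z = f x y z"
    using ex_det_protocol[OF assms] by blast
  have "cost_at_most A (return_pmf P) (size P)"
    by (simp add: cost_at_most_def bits_sent_le_size)
  moreover have "computes A (return_pmf P) f"
    using P by (simp add: computes_def)
  ultimately have "{k. \<exists>D. cost_at_most A D k \<and> computes A D f} \<noteq> {}"
    by blast
  from Inf_nat_def1[OF this] show ?thesis
    by (simp add: rand_comm_def)
qed

end

theory Submission
  imports Defs
begin

text \<open>
  Fill the group table of the integers modulo \<open>N = 2 ^ (n - 1)\<close> with \<open>2 \<times> 2\<close> blocks, the block in
  cell \<open>(x, y)\<close> being one of the two Latin squares of order 2 according to a bit \<open>r (x, y)\<close>. A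
  protocol for the resulting square recovers \<open>r (x, y)\<close> from the inputs \<open>x\<close>, \<open>y\<close> and
  \<open>(x + y) mod N\<close>. For a random \<open>r\<close> the bits are balanced up to \<open>5 * N * sqrt N\<close> on each of the
  \<open>8 ^ N\<close> boxes \<open>A \<times> B \<times> C\<close>. A protocol of cost \<open>k\<close> cuts the inputs into at most \<open>2 ^ k\<close> boxes,
  so an advantage of \<open>N ^ 2 / 3\<close> over random guessing requires
  \<open>2 ^ k * (5 * N * sqrt N) \<ge> N ^ 2 / 3\<close>.
\<close>

section \<open>Signs of small discrepancy\<close>

text \<open>The quadratic bounds on \<open>exp y\<close> and \<open>exp (- y)\<close> add up to
  \<open>2 + 2 * y\<^sup>2\<close>. The result is a weak form of
  \<open>cosh x \<le> exp (x\<^sup>2 / 2)\<close>, used to pay for one random sign in an exponential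
  moment.\<close>

lemma exp_add_exp_uminus_le:
  fixes x :: real
  assumes "\<bar>x\<bar> \<le> 1"
  shows "exp x + exp (- x) \<le> 2 * exp (x\<^sup>2)"
proof -
  have "exp y + exp (- y) \<le> 2 * exp (y\<^sup>2)" if "0 \<le> y" "y \<le> 1" for y :: real
  proof -
    have "inverse (exp y) \<le> inverse (1 + y)"
      using that by (intro le_imp_inverse_le) auto
    also have "\<dots> \<le> 1 - y + y\<^sup>2"
    proof -
      \<comment> \<open>The product is \<open>1 + y ^ 3\<close>.\<close>
      have "1 \<le> (1 - y + y\<^sup>2) * (1 + y)"
        using that by (simp add: algebra_simps power2_eq_square)
      then show ?thesis
        using that by (simp add: field_simps)
    qed
    finally have "exp (- y) \<le> 1 - y + y\<^sup>2"
      by (simp add: exp_minus)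
    moreover have "exp y \<le> 1 + y + y\<^sup>2"
      using that by (rule exp_bound)
    moreover have "1 + y\<^sup>2 \<le> exp (y\<^sup>2)"
      by simp
    ultimately show ?thesis
      by linarith
  qed
  from this[of "\<bar>x\<bar>"] show ?thesis
    using assms by (cases "x \<ge> 0") (simp_all add: add.commute)
qed

text \<open>
  The signs are chosen one at a time so that the exponential moment summed over \<open>I\<close> stays below
  its average (method of conditional expectations).
\<close>

lemma exists_signs_exp_moment:
  fixes w :: "'i \<Rightarrow> 'a \<Rightarrow> real" and t :: real
  assumes "finite S" and "finite I"
    and w: "\<And>i s. i \<in> I \<Longrightarrow> \<bar>w i s\<bar> \<le> 1" and t: "0 \<le> t" "t \<le> 1"
  shows "\<exists>e. (\<forall>s. e s \<in> {1, -1}) \<and>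
    (\<Sum>i\<in>I. exp (t * (\<Sum>s\<in>S. e s * w i s))) \<le> card I * exp (card S * t\<^sup>2)"
  using assms(1)
proof (induction S rule: finite_induct)
  case empty
  then show ?case by (intro exI[of _ "\<lambda>_. 1"]) simp
next
  case (insert a S)
  then obtain e where e: "\<forall>s. e s \<in> {1, -1}"
    and le: "(\<Sum>i\<in>I. exp (t * (\<Sum>s\<in>S. e s * w i s))) \<le> card I * exp (card S * t\<^sup>2)"
    by blast
  define X where "X i = exp (t * (\<Sum>s\<in>S. e s * w i s))" for i
  define F where "F c = (\<Sum>i\<in>I. exp (t * (\<Sum>s\<in>insert a S. (e(a := c)) s * w i s))) " for c
  have F: "F c = (\<Sum>i\<in>I. X i * exp (t * (c * w i a)))" for c
  proof -
    have "(\<Sum>s\<in>S. (e(a := c)) s * w i s) = (\<Sum>s\<in>S. e s * w i s)" for i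
      using insert.hyps by (intro sum.cong) auto
    then show ?thesis
      using insert.hyps
      by (simp add: F_def X_def sum.insert distrib_left exp_add mult.commute)
  qed
  \<comment> \<open>The average of \<open>F 1\<close> and \<open>F (- 1)\<close> exceeds the
    previous moment by at most the factor \<open>exp (t\<^sup>2)\<close>, so the better of the two
    signs for \<open>a\<close> keeps the bound.\<close>
  have "F 1 + F (- 1) = (\<Sum>i\<in>I. X i * (exp (t * w i a) + exp (- (t * w i a))))"
    by (simp add: F sum.distrib distrib_left)
  also have "\<dots> \<le> (\<Sum>i\<in>I. X i * (2 * exp (t\<^sup>2)))"
  proof (intro sum_mono mult_left_mono)
    fix i assume "i \<in> I"
    then have tw: "\<bar>t * w i a\<bar> \<le> t"
      using w[of i a] t by (simp add: abs_mult mult_left_le)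
    then have "exp (t * w i a) + exp (- (t * w i a)) \<le> 2 * exp ((t * w i a)\<^sup>2)"
      using t by (intro exp_add_exp_uminus_le) linarith
    also have "(t * w i a)\<^sup>2 \<le> t\<^sup>2"
      using tw t by (simp add: abs_le_square_iff[symmetric])
    finally show "exp (t * w i a) + exp (- (t * w i a)) \<le> 2 * exp (t\<^sup>2)"
      by simp
  qed (simp add: X_def)
  also have "\<dots> = 2 * (exp (t\<^sup>2) * (\<Sum>i\<in>I. X i))"
    by (simp add: sum_distrib_left sum_distrib_right mult_ac)
  also have "\<dots> \<le> 2 * (exp (t\<^sup>2) * (card I * exp (card S * t\<^sup>2)))"
    using le by (simp add: X_def)
  also have "\<dots> = 2 * (card I * exp (card (insert a S) * t\<^sup>2))"
    using insert.hyps by (simp add: distrib_right exp_add mult_ac)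
  finally have "F 1 \<le> card I * exp (card (insert a S) * t\<^sup>2) \<or>
      F (- 1) \<le> card I * exp (card (insert a S) * t\<^sup>2)"
    by linarith
  then obtain c where "c \<in> {1, -1}" "F c \<le> card I * exp (card (insert a S) * t\<^sup>2)"
    by blast
  then show ?case
    using e by (intro exI[of _ "e(a := c)"]) (auto simp: F_def)
qed

text \<open>Indexing by each set together with a sign \<open>c\<close> turns the one-sided moment
  into a bound on absolute values, at the price of the factor 2. All terms of the moment are
  positive, so each is at most the whole sum; this takes the place of a union bound.\<close>

lemma exists_signs_small_sums:
  fixes S :: "'a set" and \<T> :: "'a set set" and t :: real
  assumes "finite S" "finite \<T>" and sub: "\<And>T. T \<in> \<T> \<Longrightarrow> T \<subseteq> S" and t: "0 \<le> t" "t \<le> 1"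
  shows "\<exists>e. (\<forall>s. e s \<in> {1, -1}) \<and>
    (\<forall>T\<in>\<T>. exp (t * \<bar>\<Sum>s\<in>T. e s\<bar>) \<le> 2 * card \<T> * exp (card S * t\<^sup>2))"
proof -
  define I where "I = \<T> \<times> {1, -1 :: real}"
  define w where "w = (\<lambda>(T :: 'a set, c) s. if s \<in> T then c else (0::real))"
  have fin: "finite I"
    using assms by (simp add: I_def)
  have "\<bar>w i s\<bar> \<le> 1" if "i \<in> I" for i s
    using that by (auto simp: w_def I_def)
  from exists_signs_exp_moment[of S I w t, OF \<open>finite S\<close> fin this t]
  obtain e where e: "\<forall>s. e s \<in> {1, -1}"
    and le: "(\<Sum>i\<in>I. exp (t * (\<Sum>s\<in>S. e s * w i s))) \<le> card I * exp (card S * t\<^sup>2)"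
    by blast
  have "exp (t * \<bar>\<Sum>s\<in>T. e s\<bar>) \<le> 2 * card \<T> * exp (card S * t\<^sup>2)" if T: "T \<in> \<T>" for T
  proof -
    obtain c :: real where c: "c \<in> {1, -1}" "\<bar>\<Sum>s\<in>T. e s\<bar> = c * (\<Sum>s\<in>T. e s)"
      using that[of 1] that[of "-1"] by (cases "(\<Sum>s\<in>T. e s) \<ge> 0") auto
    have "(\<Sum>s\<in>S. e s * w (T, c) s) = (\<Sum>s\<in>T. e s * c)"
      using sub[OF T] \<open>finite S\<close> c(1)
      by (intro sum.mono_neutral_cong_right) (auto simp: w_def)
    also have "\<dots> = \<bar>\<Sum>s\<in>T. e s\<bar>"
      by (simp add: c(2) sum_distrib_left mult.commute)
    finally have "exp (t * \<bar>\<Sum>s\<in>T. e s\<bar>) = exp (t * (\<Sum>s\<in>S. e s * w (T, c) s))"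
      by simp
    also have "\<dots> \<le> (\<Sum>i\<in>I. exp (t * (\<Sum>s\<in>S. e s * w i s)))"
      using fin T c by (intro member_le_sum) (auto simp: I_def)
    also have "\<dots> \<le> card I * exp (card S * t\<^sup>2)"
      by (rule le)
    finally show ?thesis
      by (simp add: I_def card_cartesian_product)
  qed
  with e show ?thesis by blast
qed

section \<open>Protocols and boxes\<close>

text \<open>The hard inputs are a family of triples indexed by \<open>S\<close>, not a full cube.
  The set defined here is the trace of the box \<open>A \<times> B \<times> C\<close> on that
  family.\<close>

definition input_box :: "'i set \<Rightarrow> ('i \<Rightarrow> 'a) \<Rightarrow> ('i \<Rightarrow> 'a) \<Rightarrow> ('i \<Rightarrow> 'a) \<Rightarrow> 'a set \<Rightarrow> 'a set \<Rightarrow> 'a set \<Rightarrow> 'i set"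
  where "input_box S u v w A B C = {i \<in> S. u i \<in> A \<and> v i \<in> B \<and> w i \<in> C}"

definition sgn_bool :: "bool \<Rightarrow> real" where
  "sgn_bool b = (if b then 1 else - 1)"

text \<open>The inputs reaching a leaf form a box on which the output is constant, so a leaf
  contributes at most \<open>K\<close>, and there are at most \<open>2 ^ k\<close> relevant leaves.
  The cost is bounded only on the current box, so that each half of a cut inherits the bound with
  \<open>k\<close> lowered by one.\<close>

lemma protocol_correlation_le:
  fixes e :: "'i \<Rightarrow> real" and u v w :: "'i \<Rightarrow> 'a"
  assumes fin: "finite S"
    and K: "\<And>A B C. \<bar>\<Sum>i\<in>input_box S u v w A B C. e i\<bar> \<le> K"
    and cost: "\<forall>x\<in>A. \<forall>y\<in>B. \<forall>z\<in>C. bits_sent P x y z \<le> k"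
  shows "\<bar>\<Sum>i\<in>input_box S u v w A B C. sgn_bool (protocol_output P (u i) (v i) (w i)) * e i\<bar> \<le> 2 ^ k * K"
  using cost
proof (induction P arbitrary: A B C k)
  case (Output b)
  have "0 \<le> K"
    using K[of A B C] by linarith
  have "\<bar>\<Sum>i\<in>input_box S u v w A B C. sgn_bool b * e i\<bar> = \<bar>\<Sum>i\<in>input_box S u v w A B C. e i\<bar>"
    by (simp add: sgn_bool_def sum_negf)
  also have "\<dots> \<le> 1 * K"
    using K by simp
  also have "\<dots> \<le> 2 ^ k * K"
    using \<open>0 \<le> K\<close> by (intro mult_right_mono) auto
  finally show ?case by simp
next
  case (Speak j b P Q)
  have K0: "0 \<le> K"
    using K[of A B C] by linarith
  let ?g = "\<lambda>R i. sgn_bool (protocol_output R (u i) (v i) (w i)) * e i"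
  show ?case
  \<comment> \<open>On an empty box the cost bound is vacuous and \<open>k\<close> may be 0 although
    a bit is spoken.\<close>
  proof (cases "A = {} \<or> B = {} \<or> C = {}")
    case True
    then have "input_box S u v w A B C = {}"
      by (auto simp: input_box_def)
    then show ?thesis
      using K0 by simp
  next
    case False
    with Speak.prems have "k \<noteq> 0"
      by fastforce
    then obtain l where k: "k = Suc l"
      using not0_implies_Suc by blast
    \<comment> \<open>The bit depends on the speaker's input alone, so only that side of the box is
      cut and both parts are boxes again.\<close>
    define cut where "cut i c X = (if j = i then {x \<in> X. b x = c} else X)" for i c and X :: "'a set"
    define T where "T c = input_box S u v w (cut Player1 c A) (cut Player2 c B) (cut Player3 c C)" for c
    have T: "T c = {i \<in> input_box S u v w A B C. b (held_input j (u i) (v i) (w i)) = c}" for c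
      by (cases j) (auto simp: T_def input_box_def cut_def)
    have fT: "finite (T c)" for c
      using fin by (auto simp: T input_box_def)
    have "(\<Sum>i\<in>input_box S u v w A B C. ?g (Speak j b P Q) i)
        = (\<Sum>i\<in>T True \<union> T False. ?g (Speak j b P Q) i)"
      by (intro sum.cong) (auto simp: T)
    also have "\<dots> = (\<Sum>i\<in>T True. ?g (Speak j b P Q) i) + (\<Sum>i\<in>T False. ?g (Speak j b P Q) i)"
      using fT[of True] fT[of False] by (intro sum.union_disjoint) (simp_all add: T disjoint_iff)
    also have "\<dots> = (\<Sum>i\<in>T True. ?g P i) + (\<Sum>i\<in>T False. ?g Q i)"
      by (intro arg_cong2[of _ _ _ _ "(+)"] sum.cong) (auto simp: T)
    finally have split: "(\<Sum>i\<in>input_box S u v w A B C. ?g (Speak j b P Q) i)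
        = (\<Sum>i\<in>T True. ?g P i) + (\<Sum>i\<in>T False. ?g Q i)" .
    have "\<bar>\<Sum>i\<in>T True. ?g P i\<bar> \<le> 2 ^ l * K"
      unfolding T_def
    proof (rule Speak.IH(1), intro ballI)
      fix x y z
      assume "x \<in> cut Player1 True A" "y \<in> cut Player2 True B" "z \<in> cut Player3 True C"
      then show "bits_sent P x y z \<le> l"
        using Speak.prems[rule_format, of x y z] by (cases j) (auto simp: cut_def k)
    qed
    moreover have "\<bar>\<Sum>i\<in>T False. ?g Q i\<bar> \<le> 2 ^ l * K"
      unfolding T_def
    proof (rule Speak.IH(2), intro ballI)
      fix x y z
      assume "x \<in> cut Player1 False A" "y \<in> cut Player2 False B" "z \<in> cut Player3 False C"
      then show "bits_sent Q x y z \<le> l"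
        using Speak.prems[rule_format, of x y z] by (cases j) (auto simp: cut_def k)
    qed
    ultimately show ?thesis
      unfolding split k by simp
  qed
qed

text \<open>Success probability 2/3 means expected sign agreement at least
  \<open>2 * (2 / 3) - 1 = 1 / 3\<close> at every point of \<open>S\<close>. Summing over
  \<open>S\<close> and exchanging sum and expectation leaves deterministic protocols, each with
  correlation at most \<open>2 ^ k * K\<close>.\<close>

lemma discrepancy_bound:
  fixes f :: "'a \<Rightarrow> 'a \<Rightarrow> 'a \<Rightarrow> bool" and u v w :: "'i \<Rightarrow> 'a"
  assumes fin: "finite S"
    and X: "\<And>i. i \<in> S \<Longrightarrow> u i \<in> X \<and> v i \<in> X \<and> w i \<in> X"
    and K: "\<And>A B C. \<bar>\<Sum>i\<in>input_box S u v w A B C. sgn_bool (f (u i) (v i) (w i))\<bar> \<le> K"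
    and cost: "cost_at_most X D k" and comp: "computes X D f"
  shows "card S / 3 \<le> 2 ^ k * K"
proof -
  let ?F = "\<lambda>i. f (u i) (v i) (w i)"
  let ?O = "\<lambda>P i. protocol_output P (u i) (v i) (w i)"
  have eq: "sgn_bool (?O P i) * sgn_bool (?F i) = 2 * indicator {P. ?O P i = ?F i} P - 1" for P i
    by (auto simp: sgn_bool_def indicator_def)
  have int: "integrable (measure_pmf D) (\<lambda>P. sgn_bool (?O P i) * sgn_bool (?F i))" for i
    by (rule measure_pmf.integrable_const_bound[where B = 1]) (auto simp: sgn_bool_def)
  have "card S / 3 = (\<Sum>i\<in>S. 1 / 3 :: real)"
    by simp
  also have "\<dots> \<le> (\<Sum>i\<in>S. measure_pmf.expectation D (\<lambda>P. sgn_bool (?O P i) * sgn_bool (?F i)))"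
  proof (rule sum_mono)
    fix i assume "i \<in> S"
    then have "measure_pmf.prob D {P. ?O P i = ?F i} \<ge> 2 / 3"
      using comp X by (auto simp: computes_def)
    then show "1 / 3 \<le> measure_pmf.expectation D (\<lambda>P. sgn_bool (?O P i) * sgn_bool (?F i))"
      unfolding eq
      by (subst Bochner_Integration.integral_diff)
        (auto intro!: integrable_mult_right measure_pmf.integrable_const_bound[where B = 1])
  qed
  also have "\<dots> = measure_pmf.expectation D (\<lambda>P. \<Sum>i\<in>S. sgn_bool (?O P i) * sgn_bool (?F i))"
    using int by (intro Bochner_Integration.integral_sum[symmetric]) 
  also have "\<dots> \<le> 2 ^ k * K"
  proof (rule measure_pmf.integral_le_const)
    show "AE P in measure_pmf D. (\<Sum>i\<in>S. sgn_bool (?O P i) * sgn_bool (?F i)) \<le> 2 ^ k * K"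
    proof (rule AE_pmfI)
      fix P assume "P \<in> set_pmf D"
      then have "\<forall>x\<in>X. \<forall>y\<in>X. \<forall>z\<in>X. bits_sent P x y z \<le> k"
        using cost by (auto simp: cost_at_most_def)
      from protocol_correlation_le[OF fin K this]
      have "(\<Sum>i\<in>input_box S u v w X X X. sgn_bool (?O P i) * sgn_bool (?F i)) \<le> 2 ^ k * K"
        by linarith
      also have "input_box S u v w X X X = S"
        using X by (auto simp: input_box_def)
      finally show "(\<Sum>i\<in>S. sgn_bool (?O P i) * sgn_bool (?F i)) \<le> 2 ^ k * K" .
    qed
  qed (use int in auto)
  finally show ?thesis .
qed

section \<open>The Latin square\<close>

text \<open>Indices in \<open>{1..2 * N}\<close> are shifted by 1 and split into a digit modulo
  \<open>N\<close>, which selects the block, and a high digit in \<open>{0, 1}\<close>, which is the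
  position inside it. The rows of one block are thus \<open>N\<close> apart.\<close>

definition block_square :: "nat \<Rightarrow> (nat \<times> nat \<Rightarrow> bool) \<Rightarrow> nat \<Rightarrow> nat \<Rightarrow> nat" where
  "block_square N r x y =
     1 + ((x - 1) mod N + (y - 1) mod N) mod N +
     N * (((x - 1) div N + (y - 1) div N + of_bool (r ((x - 1) mod N, (y - 1) mod N))) mod 2)"

text \<open>Reduces the condition on columns to the one on rows.\<close>

lemma block_square_swap: "block_square N r x y = block_square N (r \<circ> prod.swap) y x"
  by (simp add: block_square_def add.commute)

lemma block_square_in_range:
  assumes "0 < N"
  shows "block_square N r x y \<in> {1..2 * N}"
proof -
  have "a < N \<Longrightarrow> b < 2 \<Longrightarrow> 1 + a + N * b \<in> {1..2 * N}" for a b :: nat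
    by (auto simp: less_2_cases_iff)
  then show ?thesis
    using assms by (simp add: block_square_def del: atLeastAtMost_iff)
qed

lemma mod_add_left_cancel:
  fixes a b x N :: nat
  assumes "(x + a) mod N = (x + b) mod N" "a < N" "b < N"
  shows "a = b"
proof -
  have "a = b" if "(x + a) mod N = (x + b) mod N" "a < N" "b < N" "a \<le> b" for a b
  proof -
    have "N dvd (x + b) - (x + a)"
      using that mod_eq_dvd_iff_nat[of "x + a" "x + b" N] by simp
    then show "a = b"
      using that by (auto dest: dvd_imp_le)
  qed
  from this[of a b] this[of b a] show ?thesis
    using assms by linarith
qed

text \<open>The low digit of the entry determines the low digit of \<open>y\<close>. The bit of
  \<open>r\<close> is then the same for \<open>y\<close> and \<open>y'\<close>, so the high digit of
  \<open>y\<close> can be cancelled out of the sum modulo 2.\<close>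

lemma block_square_inj:
  assumes N: "0 < N"
  shows "inj_on (block_square N r x) {1..2 * N}"
proof (rule inj_onI)
  fix y y' assume y: "y \<in> {1..2 * N}" "y' \<in> {1..2 * N}"
    and eq: "block_square N r x y = block_square N r x y'"
  have digits: "a = a' \<and> b = b'" if "1 + a + N * b = 1 + a' + N * b'" "a < N" "a' < N"
    for a a' b b' :: nat
  proof -
    have "(a + N * b) mod N = (a' + N * b') mod N" "(a + N * b) div N = (a' + N * b') div N"
      using that by simp_all
    then show ?thesis
      using that by simp
  qed
  have 1: "((x - 1) mod N + (y - 1) mod N) mod N = ((x - 1) mod N + (y' - 1) mod N) mod N"
    and 2: "((x - 1) div N + (y - 1) div N + of_bool (r ((x - 1) mod N, (y - 1) mod N))) mod 2 =
      ((x - 1) div N + (y' - 1) div N + of_bool (r ((x - 1) mod N, (y' - 1) mod N))) mod 2"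
    using digits[OF eq[unfolded block_square_def]] N by auto
  have m: "(y - 1) mod N = (y' - 1) mod N"
    by (rule mod_add_left_cancel[OF 1]) (use N in auto)
  have lt: "(y - 1) div N < 2" "(y' - 1) div N < 2"
    using y N by (auto simp: div_less_iff_less_mult)
  have 3: "((x - 1) div N + of_bool (r ((x - 1) mod N, (y - 1) mod N)) + (y - 1) div N) mod 2 =
      ((x - 1) div N + of_bool (r ((x - 1) mod N, (y - 1) mod N)) + (y' - 1) div N) mod 2"
    using 2 m by (simp add: add_ac)
  have "(y - 1) div N = (y' - 1) div N"
    by (rule mod_add_left_cancel[OF 3 lt])
  with m have "y - 1 = y' - 1"
    by (metis div_mult_mod_eq)
  then show "y = y'"
    using y by auto
qed

lemma latin_square_block_square:
  assumes "0 < N"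
  shows "latin_square (2 * N) (block_square N r)"
proof -
  have *: "bij_betw (block_square N r x) {1..2 * N} {1..2 * N}" for r x
    using block_square_inj[OF assms] block_square_in_range[OF assms]
    by (intro bij_betw_imageI endo_inj_surj) auto
  have "(\<lambda>x. block_square N r x y) = block_square N (r \<circ> prod.swap) y" for y
    by (rule ext) (rule block_square_swap)
  then show ?thesis
    using * by (simp add: latin_square_def)
qed

text \<open>Both high digits vanish here, so the entry is \<open>(x + y) mod N + 1\<close>,
  increased by \<open>N\<close> exactly when the bit is set.\<close>

lemma latin_fun_block_square:
  assumes "x < N" "y < N"
  shows "latin_fun (block_square N r) (x + 1) (y + 1) ((x + y) mod N + 1) \<longleftrightarrow> r (x, y)"
  using assms by (simp add: latin_fun_def block_square_def)

lemma exists_balanced_signs: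
  fixes N :: nat
  assumes N: "0 < N"
  shows "\<exists>r. \<forall>A B C. \<bar>\<Sum>i\<in>input_box ({..<N} \<times> {..<N}) (\<lambda>i. fst i + 1) (\<lambda>i. snd i + 1)
    (\<lambda>i. (fst i + snd i) mod N + 1) A B C. sgn_bool (r i)\<bar> \<le> 5 * N * sqrt N"
proof -
  define S where "S = {..<N} \<times> {..<N}"
  define bx where "bx = input_box S (\<lambda>i. fst i + 1) (\<lambda>i. snd i + 1) (\<lambda>i. (fst i + snd i) mod N + 1)"
  define \<B> where "\<B> = Pow {1..N} \<times> Pow {1..N} \<times> Pow {1..N}"
  define \<T> where "\<T> = (\<lambda>(A, B, C). bx A B C) ` \<B>"
  \<comment> \<open>All coordinates of the family lie in \<open>{1..N}\<close>, so arbitrary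
    \<open>A\<close>, \<open>B\<close>, \<open>C\<close> yield only finitely many boxes.\<close>
  have cut: "bx A B C = bx (A \<inter> {1..N}) (B \<inter> {1..N}) (C \<inter> {1..N})" for A B C
  proof -
    have "(a + b) mod N < N" for a b
      using N by simp
    then show ?thesis
      by (auto simp: bx_def input_box_def S_def Suc_le_eq)
  qed
  then have mem: "bx A B C \<in> \<T>" for A B C
    unfolding \<T>_def \<B>_def by (auto intro!: image_eqI[of _ _ "(A \<inter> {1..N}, B \<inter> {1..N}, C \<inter> {1..N})"])
  have "card \<T> \<le> card \<B>"
    unfolding \<T>_def by (rule card_image_le) (simp add: \<B>_def)
  also have "\<dots> = 8 ^ N"
    by (simp add: \<B>_def card_cartesian_product card_Pow flip: power_mult_distrib)
  finally have "real (card \<T>) \<le> 8 ^ N"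
    by (metis of_nat_le_iff of_nat_numeral of_nat_power)
  \<comment> \<open>The factor 2 is absorbed into \<open>2 ^ N\<close>, and
    \<open>16 ^ N \<le> exp (4 * N)\<close> because \<open>2 \<le> exp 1\<close>.\<close>
  then have "2 * real (card \<T>) \<le> 2 ^ N * 8 ^ N"
    using N by (intro mult_mono) (auto simp: self_le_power)
  also have "\<dots> = (2 ^ 4) ^ N"
    by (simp flip: power_mult_distrib)
  also have "\<dots> \<le> (exp 1 ^ 4) ^ N"
    using exp_ge_add_one_self[of 1] by (intro power_mono) auto
  also have "\<dots> = exp (4 * real N)"
    by (simp add: exp_of_nat_mult[symmetric] mult.commute flip: power_mult)
  finally have card_le: "2 * real (card \<T>) \<le> exp (4 * real N)" .
  \<comment> \<open>This \<open>t\<close> makes the variance term \<open>card S * t\<^sup>2\<close>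
    equal to \<open>N\<close>, the same order as the logarithm of the number of boxes. The exponents
    total \<open>5 * N\<close>, and dividing by \<open>t\<close> gives
    \<open>5 * N * sqrt N\<close>.\<close>
  define t where "t = 1 / sqrt N"
  have t: "0 < t" "t \<le> 1" "card S * t\<^sup>2 = N"
    using N by (auto simp: t_def S_def card_cartesian_product power_divide)
  have "finite S" "finite \<T>" "\<And>T. T \<in> \<T> \<Longrightarrow> T \<subseteq> S"
    by (auto simp: S_def \<T>_def \<B>_def bx_def input_box_def)
  from exists_signs_small_sums[OF this, of t] t
  obtain e :: "nat \<times> nat \<Rightarrow> real" where e: "\<forall>s. e s \<in> {1, -1}"
    and le: "\<forall>T\<in>\<T>. exp (t * \<bar>\<Sum>s\<in>T. e s\<bar>) \<le> 2 * card \<T> * exp (real N)"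
    by auto
  have sgn: "sgn_bool (e i = 1) = e i" for i
    using e[rule_format, of i] by (auto simp: sgn_bool_def)
  have "\<bar>\<Sum>i\<in>bx A B C. sgn_bool (e i = 1)\<bar> \<le> 5 * N * sqrt N" for A B C
  proof -
    have "exp (t * \<bar>\<Sum>i\<in>bx A B C. e i\<bar>) \<le> 2 * card \<T> * exp (real N)"
      using le mem by blast
    also have "\<dots> \<le> exp (4 * real N) * exp (real N)"
      using card_le by (intro mult_right_mono) auto
    also have "\<dots> = exp (5 * real N)"
      by (simp flip: exp_add)
    finally have "t * \<bar>\<Sum>i\<in>bx A B C. e i\<bar> \<le> 5 * N"
      by simp
    then show ?thesis
      using N by (simp add: sgn t_def field_simps)
  qed
  then show ?thesis
    by (intro exI[of _ "\<lambda>i. e i = 1"]) (simp add: bx_def S_def)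
qed

text \<open>With \<open>N = 2 ^ m\<close> and \<open>N\<^sup>2\<close> hard inputs, the discrepancy
  bound reads \<open>N\<^sup>2 / 3 \<le> 2 ^ k * (5 * N * sqrt N)\<close>, that is
  \<open>sqrt N \<le> 15 * 2 ^ k\<close>; squaring and comparing exponents of 2 bounds
  \<open>m\<close>.\<close>

lemma exists_hard_latin_square:
  "\<exists>L. latin_square (2 ^ Suc m) L \<and> m \<le> 2 * rand_comm {1..2 ^ Suc m} (latin_fun L) + 8"
proof -
  define N :: nat where "N = 2 ^ m"
  have N: "0 < N"
    by (simp add: N_def)
  define S where "S = {..<N} \<times> {..<N}"
  let ?u = "\<lambda>i::nat \<times> nat. fst i + 1" and ?v = "\<lambda>i::nat \<times> nat. snd i + 1"
    and ?w = "\<lambda>i::nat \<times> nat. (fst i + snd i) mod N + 1"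
  obtain r where r: "\<And>A B C. \<bar>\<Sum>i\<in>input_box S ?u ?v ?w A B C. sgn_bool (r i)\<bar> \<le> 5 * N * sqrt N"
    using exists_balanced_signs[OF N] unfolding S_def by blast
  let ?f = "latin_fun (block_square N r)"
  define k where "k = rand_comm {1..2 * N} ?f"
  obtain D where D: "cost_at_most {1..2 * N} D k" "computes {1..2 * N} D ?f"
    using rand_comm_attained[of "{1..2 * N}" ?f] by (auto simp: k_def)
  have f: "?f (?u i) (?v i) (?w i) = r i" if "i \<in> S" for i
    using that latin_fun_block_square[of "fst i" N "snd i" r] by (auto simp: S_def)
  have "card S / 3 \<le> 2 ^ k * (5 * N * sqrt N)"
  proof (rule discrepancy_bound[where u = ?u and v = ?v and w = ?w, OF _ _ _ D])
    fix A B C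
    have "(\<Sum>i\<in>input_box S ?u ?v ?w A B C. sgn_bool (?f (?u i) (?v i) (?w i)))
        = (\<Sum>i\<in>input_box S ?u ?v ?w A B C. sgn_bool (r i))"
      by (intro sum.cong refl arg_cong[of _ _ sgn_bool] f) (simp add: input_box_def)
    then show "\<bar>\<Sum>i\<in>input_box S ?u ?v ?w A B C. sgn_bool (?f (?u i) (?v i) (?w i))\<bar> \<le> 5 * N * sqrt N"
      using r by simp
  next
    fix i assume "i \<in> S"
    moreover have "(fst i + snd i) mod N < N"
      using N by simp
    ultimately show "?u i \<in> {1..2 * N} \<and> ?v i \<in> {1..2 * N} \<and> ?w i \<in> {1..2 * N}"
      by (auto simp: S_def)
  qed (simp add: S_def)
  then have "N * (sqrt N * sqrt N) \<le> N * (15 * 2 ^ k * sqrt N)"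
    by (simp add: S_def card_cartesian_product mult_ac)
  then have "sqrt N \<le> 15 * 2 ^ k"
    using N by (intro mult_right_le_imp_le[of "sqrt N" "sqrt N" "15 * 2 ^ k"]) simp_all
  then have "(sqrt N)\<^sup>2 \<le> (15 * 2 ^ k)\<^sup>2"
    by (intro power_mono) auto
  then have "real N \<le> 225 * 2 ^ (2 * k)"
    by (simp add: power_mult_distrib power_mult[symmetric] mult.commute)
  \<comment> \<open>Here \<open>225 \<le> 2 ^ 8\<close>.\<close>
  also have "\<dots> \<le> 2 ^ (2 * k + 8)"
    by (simp add: power_add)
  finally have "m \<le> 2 * k + 8"
    by (simp add: N_def)
  moreover have "latin_square (2 * N) (block_square N r)"
    using N by (rule latin_square_block_square)
  ultimately show ?thesis
    unfolding k_def by (intro exI[of _ "block_square N r"]) (simp add: N_def)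
qed

theorem theorem7:
  "\<exists>c::real. c > 0 \<and>
     (\<exists>n0::nat. \<forall>n\<ge>n0. \<exists>L. latin_square (2 ^ n) L \<and>
        real (rand_comm {1..2 ^ n} (latin_fun L)) \<ge> c * real n)"
proof (intro exI[of _ "1 / 4 :: real"] exI[of _ "18 :: nat"] conjI allI impI)
  \<comment> \<open>With \<open>m = n - 1\<close> the cost is at least \<open>(n - 9) / 2\<close>,
    which is at least \<open>n / 4\<close> once \<open>n \<ge> 18\<close>.\<close>
  fix n :: nat assume n: "18 \<le> n"
  then obtain m where m: "n = Suc m"
    by (cases n) auto
  then obtain L where "latin_square (2 ^ n) L" "m \<le> 2 * rand_comm {1..2 ^ n} (latin_fun L) + 8"
    using exists_hard_latin_square[of m] by blast
  then show "\<exists>L. latin_square (2 ^ n) L \<and>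
      real (rand_comm {1..2 ^ n} (latin_fun L)) \<ge> 1 / 4 * real n"
    using n m by (intro exI[of _ L]) simp
qed simp

end
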